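(* For $i=1,\ldots,4$ let $f^i=(f_{1i},\ldots,f_{n_ii})'$ be a $q_i$-level balanced column, and let $\mathcal{A}_i=\{0,\ldots,q_i-1\}$ be equipped with an Abelian group operation, where $\mathcal{A}_i=\mathcal{A}_j$ as groups is understood whenever a Kronecker sum over $\mathcal{A}_i$ of an $f^i$ and an $f^j$ with $q_i=q_j$ is formed. Suppose $n_1=n_3$ and $n_2=n_4$. Let $h_1=q_2\left(f^1-\frac{q_1-1}{2}\right)\oplus\left(f^2-\frac{q_2-1}{2}\right)+\frac{q_1q_2-1}{2}$ and $h_2=q_4\left(f^3-\frac{q_3-1}{2}\right)\oplus\left(f^4-\frac{q_4-1}{2}\right)+\frac{q_3q_4-1}{2}$. Then: (a) $$f_{\mathrm{NOD}}(h_1,h_2)=f_{\mathrm{NOD}}(f^1,f^3)f_{\mathrm{NOD}}(f^2,f^4)+\frac{n_2^2}{q_2q_4}f_{\mathrm{NOD}}(f^1,f^3)+\frac{n_1^2}{q_1q_3}f_{\mathrm{NOD}}(f^2,f^4);$$ (b) if $q_1=q_2$ and $q_3=q_4$, then $$f_{\mathrm{NOD}}(f^1\oplus_{\mathcal{A}_1}f^2,f^3\oplus_{\mathcal{A}_3}f^4)\le q_1q_3f_{\mathrm{NOD}}(f^1,f^3)f_{\mathrm{NOD}}(f^2,f^4)+\min\{n_2^2f_{\mathrm{NOD}}(f^1,f^3),\,n_1^2f_{\mathrm{NOD}}(f^2,f^4)\},$$ where the equality holds if and only if $f^1$ is orthogonal to $f^3$ or $f^2$ is orthogonal to $f^4$;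 (c) if $q_1=q_2$, then $$f_{\mathrm{NOD}}(f^1\oplus_{\mathcal{A}_1}f^2,h_2)\le q_1f_{\mathrm{NOD}}(f^1,f^3)f_{\mathrm{NOD}}(f^2,f^4)+\min\left\{\frac{n_2^2}{q_4}f_{\mathrm{NOD}}(f^1,f^3),\,\frac{n_1^2}{q_3}f_{\mathrm{NOD}}(f^2,f^4)\right\},$$ where the equality holds if and only if $f^1$ is orthogonal to $f^3$ or $f^2$ is orthogonal to $f^4$.
   Context: A $q$-level column is a vector with entries in $\{0,\ldots,q-1\}$; it is balanced if each of the $q$ symbols occurs equally often. For two columns $f,g$ of the same length $N$ with $q$ and $p$ levels respectively, $$f_{\mathrm{NOD}}(f,g)=\sum_{a=0}^{q-1}\sum_{b=0}^{p-1}\Big(n_{ab}(f,g)-\frac{N}{qp}\Big)^2,$$ where $n_{ab}(f,g)$ is the number of positions at which $(f,g)$ equals $(a,b)$. Two columns are orthogonal if all possible level-combinations for them appear equally often (equivalently $f_{\mathrm{NOD}}=0$). For a scalar $a$ and a matrix $B$, $a+B$ is obtained by adding $a$ to every entry of $B$. For $A=(a_{ij})$, the Kronecker sum $A\oplus B$ (respectively $A\oplus_{\mathcal{A}}B$) is the block matrix whose $(i,j)$ block is obtained by adding $a_{ij}$ to every entry of $B$, with ordinary addition (respectively addition in the group $\mathcal{A}$). In $h_1$ the multiplication by $q_2$ applies to $f^1-\frac{q_1-1}{2}$ before the Kronecker sum and the final constant is added to every entry, so $h_1$ is a $q_1q_2$-level column; similarly $h_2$ is a $q_3q_4$-level column.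 $f^1\oplus_{\mathcal{A}_1}f^2$ is a $q_1$-level column and $f^3\oplus_{\mathcal{A}_3}f^4$ is a $q_3$-level column. *)

theory Defs
  imports "Jordan_Normal_Form.Matrix" "HOL-Algebra.Group"
begin

text \<open>
  Columns are matrices with a single column. Symbols are naturals, but some columns
  have real entries, so symbols are compared with entries via \<^const>\<open>of_nat\<close>.
\<close>

definition level_column :: "nat \<Rightarrow> nat \<Rightarrow> 'a::semiring_char_0 mat \<Rightarrow> bool" where
  "level_column q N f \<longleftrightarrow>
     f \<in> carrier_mat N 1 \<and> (\<forall>i<N. \<exists>a<q. f $$ (i, 0) = of_nat a)"

definition balanced :: "nat \<Rightarrow> 'a::semiring_char_0 mat \<Rightarrow> bool" where
  "balanced q f \<longleftrightarrow>
     (\<exists>c. \<forall>a<q. card {i. i < dim_row f \<and> f $$ (i, 0) = of_nat a} = c)"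

definition level_count ::
  "'a::semiring_char_0 mat \<Rightarrow> 'b::semiring_char_0 mat \<Rightarrow> nat \<Rightarrow> nat \<Rightarrow> nat" where
  "level_count f g a b =
     card {i. i < dim_row f \<and> f $$ (i, 0) = of_nat a \<and> g $$ (i, 0) = of_nat b}"

text \<open>
  The following two notions are meant for a \<open>q\<close>-level column \<open>f\<close> and a \<open>p\<close>-level column \<open>g\<close>
  of the same length. The numbers of levels are explicit arguments, since a column need
  not determine them.
\<close>

definition f_NOD ::
  "nat \<Rightarrow> nat \<Rightarrow> 'a::semiring_char_0 mat \<Rightarrow> 'b::semiring_char_0 mat \<Rightarrow> real" where
  "f_NOD q p f g =
     (\<Sum>a<q. \<Sum>b<p. (real (level_count f g a b) - real (dim_row f) / (real q * real p))\<^sup>2)"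

definition orthogonal_columns ::
  "nat \<Rightarrow> nat \<Rightarrow> 'a::semiring_char_0 mat \<Rightarrow> 'b::semiring_char_0 mat \<Rightarrow> bool" where
  "orthogonal_columns q p f g \<longleftrightarrow> (\<exists>c. \<forall>a<q. \<forall>b<p. level_count f g a b = c)"

definition scalar_plus :: "'a::plus \<Rightarrow> 'a mat \<Rightarrow> 'a mat" where
  "scalar_plus a B = map_mat (\<lambda>x. a + x) B"

definition kronecker_by :: "('a \<Rightarrow> 'a \<Rightarrow> 'a) \<Rightarrow> 'a mat \<Rightarrow> 'a mat \<Rightarrow> 'a mat" where
  "kronecker_by pls A B =
     mat (dim_row A * dim_row B) (dim_col A * dim_col B)
       (\<lambda>(i, j). pls (A $$ (i div dim_row B, j div dim_col B))
                     (B $$ (i mod dim_row B, j mod dim_col B)))"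

definition kronecker_sum :: "'a::plus mat \<Rightarrow> 'a mat \<Rightarrow> 'a mat" where
  "kronecker_sum A B = kronecker_by (+) A B"

definition kronecker_sum_group :: "'a monoid \<Rightarrow> 'a mat \<Rightarrow> 'a mat \<Rightarrow> 'a mat" where
  "kronecker_sum_group G A B = kronecker_by (\<lambda>x y. x \<otimes>\<^bsub>G\<^esub> y) A B"

text \<open>Equality as groups: the values of the operation outside the carrier are ignored.\<close>

definition same_group :: "'a monoid \<Rightarrow> 'a monoid \<Rightarrow> bool" where
  "same_group G H \<longleftrightarrow> carrier G = carrier H \<and>
     (\<forall>x\<in>carrier G. \<forall>y\<in>carrier G. x \<otimes>\<^bsub>G\<^esub> y = x \<otimes>\<^bsub>H\<^esub> y)"

end

theory Submission
  imports Defs "HOL-Analysis.Convex"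
begin

text \<open>
  Write \<open>x\<close> and \<open>y\<close> for the deviations of the level counts of \<open>(f\<^sup>1, f\<^sup>3)\<close> and
  \<open>(f\<^sup>2, f\<^sup>4)\<close> from their means \<open>\<mu>\<close> and \<open>\<nu>\<close>; balance makes their column sums vanish. A
  level count of two Kronecker combinations is a sum of products \<open>(x + \<mu>)(y + \<nu>)\<close> over the
  pairs of levels that combine to the given one. For \<open>h\<^sub>1, h\<^sub>2\<close> the sum has a single term, and
  squaring gives (a). A group sum contributes all levels \<open>a\<close> of the first factor, paired with
  \<open>a\<^sup>-\<^sup>1 s\<close>; then the terms linear in \<open>x\<close> or \<open>y\<close> cancel and Cauchy-Schwarz bounds the whole
  by the first summand of the right-hand side in (b) and (c). Hence equality forces the
  minimum to be zero.
\<close>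

section \<open>Deviations of level counts and orthogonality\<close>

definition deviation :: "nat \<Rightarrow> nat \<Rightarrow> nat mat \<Rightarrow> nat mat \<Rightarrow> nat \<Rightarrow> nat \<Rightarrow> real" where
  "deviation q p f g a b =
     real (level_count f g a b) - real (dim_row f) / (real q * real p)"

lemma f_NOD_eq_deviation: "f_NOD q p f g = (\<Sum>a<q. \<Sum>b<p. (deviation q p f g a b)\<^sup>2)"
  by (simp add: f_NOD_def deviation_def)

lemma f_NOD_nonneg: "0 \<le> f_NOD q p f g"
  by (simp add: f_NOD_def sum_nonneg)

lemma level_columnD:
  fixes f :: "nat mat"
  assumes "level_column q N f"
  shows "dim_row f = N" "dim_col f = 1" "\<And>i. i < N \<Longrightarrow> f $$ (i, 0) < q"
  using assms by (fastforce simp: level_column_def)+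

text \<open>The \<open>q\<close> symbol classes split the \<open>N\<close> positions into disjoint
  sets of a common size \<open>c\<close>, so \<open>N = q * c\<close>.\<close>

lemma card_symbol_balanced:
  fixes f :: "nat mat"
  assumes f: "level_column q N f" and bal: "balanced q f" and a: "a < q"
  shows "real (card {i. i < N \<and> f $$ (i, 0) = a}) = real N / real q"
proof -
  obtain c where c: "\<And>a. a < q \<Longrightarrow> card {i. i < N \<and> f $$ (i, 0) = a} = c"
    using bal level_columnD(1)[OF f] by (auto simp: balanced_def)
  have "N = card (\<Union>a\<in>{..<q}. {i. i < N \<and> f $$ (i, 0) = a})"
  proof -
    have "(\<Union>a\<in>{..<q}. {i. i < N \<and> f $$ (i, 0) = a}) = {..<N}"
      using level_columnD(3)[OF f] by auto
    then show ?thesis by simp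
  qed
  also have "\<dots> = (\<Sum>a<q. card {i. i < N \<and> f $$ (i, 0) = a})"
    by (rule card_UN_disjoint) auto
  also have "\<dots> = q * c"
    using c by simp
  finally have "N = q * c" .
  then show ?thesis
    using a c by simp
qed

lemma sum_level_count:
  fixes f g :: "nat mat"
  assumes f: "level_column q N f"
  shows "(\<Sum>a<q. level_count f g a b) = card {i. i < N \<and> g $$ (i, 0) = b}"
proof -
  have "(\<Sum>a<q. level_count f g a b) =
      card (\<Union>a\<in>{..<q}. {i. i < dim_row f \<and> f $$ (i, 0) = of_nat a \<and> g $$ (i, 0) = of_nat b})"
    unfolding level_count_def by (rule card_UN_disjoint[symmetric]) auto
  also have "(\<Union>a\<in>{..<q}. {i. i < dim_row f \<and> f $$ (i, 0) = of_nat a \<and> g $$ (i, 0) = of_nat b})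
      = {i. i < N \<and> g $$ (i, 0) = b}"
    using level_columnD[OF f] by auto
  finally show ?thesis .
qed

text \<open>Summing the counts over the levels of \<open>f\<close> leaves the number of occurrences
  of \<open>b\<close> in \<open>g\<close>, which is \<open>N / p\<close> by balance of
  \<open>g\<close>. The \<open>q\<close> copies of the mean \<open>N / (q * p)\<close> add up to the
  same value.\<close>

lemma sum_deviation_fst:
  assumes "level_column q N f" "level_column p N g" "balanced p g" "0 < q" "b < p"
  shows "(\<Sum>a<q. deviation q p f g a b) = 0"
proof -
  have "(\<Sum>a<q. real (level_count f g a b)) = real N / real p"
    using sum_level_count[OF assms(1), of g b] card_symbol_balanced[OF assms(2,3,5)]
    by (metis of_nat_sum)
  then show ?thesis
    using assms(4) level_columnD(1)[OF assms(1)] by (simp add: deviation_def sum_subtractf)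
qed

lemma level_count_eq_deviation:
  fixes f g :: "nat mat"
  shows "real (level_count f g a b) = deviation q p f g a b + real (dim_row f) / (real q * real p)"
  by (simp add: deviation_def)

text \<open>Orthogonality only asserts that the counts share some value. A shared value makes the
  deviation independent of the first level, and as these deviations sum to zero, each of them is
  zero. Conversely, a vanishing sum of squares puts every count at the mean.\<close>

lemma orthogonal_columns_iff_f_NOD:
  fixes f g :: "nat mat"
  assumes f: "level_column q N f" and g: "level_column p N g"
    and bal: "balanced p g" and q: "0 < q" and p: "0 < p"
  shows "orthogonal_columns q p f g \<longleftrightarrow> f_NOD q p f g = 0"
proof -
  have zero: "f_NOD q p f g = 0 \<longleftrightarrow> (\<forall>a<q. \<forall>b<p. deviation q p f g a b = 0)"
    by (auto simp: f_NOD_eq_deviation sum_nonneg_eq_0_iff sum_nonneg)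
  show ?thesis
  proof
    assume "orthogonal_columns q p f g"
    then obtain c where c: "\<And>a b. a < q \<Longrightarrow> b < p \<Longrightarrow> level_count f g a b = c"
      by (auto simp: orthogonal_columns_def)
    have "deviation q p f g a b = 0" if ab: "a < q" "b < p" for a b
    proof -
      have "deviation q p f g a' b = deviation q p f g a b" if "a' < q" for a'
        unfolding deviation_def c[OF that ab(2)] c[OF ab] ..
      then have "0 = (\<Sum>a'<q. deviation q p f g a b)"
        unfolding sum_deviation_fst[OF f g bal q ab(2), symmetric] by (intro sum.cong) auto
      then show ?thesis
        using q by simp
    qed
    with zero show "f_NOD q p f g = 0" by blast
  next
    assume "f_NOD q p f g = 0"
    then have dev: "\<And>a b. a < q \<Longrightarrow> b < p \<Longrightarrow> deviation q p f g a b = 0"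
      using zero by blast
    have "level_count f g a b = level_count f g 0 0" if "a < q" "b < p" for a b
    proof -
      have "real (level_count f g a b) = real (level_count f g 0 0)"
        using dev[OF that] dev[OF q p] unfolding deviation_def by linarith
      then show ?thesis by (rule of_nat_eq_iff[THEN iffD1])
    qed
    then show "orthogonal_columns q p f g"
      unfolding orthogonal_columns_def by blast
  qed
qed

lemma f_NOD_empty:
  assumes "dim_row f = 0"
  shows "f_NOD q p f g = 0"
  using assms by (simp add: f_NOD_def level_count_def)

section \<open>Level counts of Kronecker combinations\<close>

text \<open>Here \<open>\<pi>\<close> on \<open>I\<close> enumerates the solutions of \<open>u a c = s\<close>, and \<open>\<rho>\<close> on \<open>J\<close> those of
  \<open>v b d = t\<close>.\<close>

lemma level_count_kronecker_by:
  fixes f1 f2 f3 f4 :: "nat mat"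
  assumes f1: "level_column q1 n1 f1" and f2: "level_column q2 n2 f2"
    and f3: "level_column q3 n1 f3" and f4: "level_column q4 n2 f4"
    and I: "\<And>a c. a < q1 \<Longrightarrow> c < q2 \<Longrightarrow> u a c = s \<longleftrightarrow> a \<in> I \<and> c = \<pi> a"
    and J: "\<And>b d. b < q3 \<Longrightarrow> d < q4 \<Longrightarrow> v b d = t \<longleftrightarrow> b \<in> J \<and> d = \<rho> b"
    and fin: "finite I" "finite J"
    and sub: "I \<subseteq> {..<q1}" "J \<subseteq> {..<q3}" "\<pi> ` I \<subseteq> {..<q2}" "\<rho> ` J \<subseteq> {..<q4}"
  shows "level_count (kronecker_by u f1 f2) (kronecker_by v f3 f4) s t =
    (\<Sum>a\<in>I. \<Sum>b\<in>J. level_count f1 f3 a b * level_count f2 f4 (\<pi> a) (\<rho> b))"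
proof -
  note l = level_columnD[OF f1] level_columnD[OF f2] level_columnD[OF f3] level_columnD[OF f4]
  define S where "S a b = {i. i < n1 \<and> f1 $$ (i, 0) = a \<and> f3 $$ (i, 0) = b}" for a b
  define T where "T c d = {j. j < n2 \<and> f2 $$ (j, 0) = c \<and> f4 $$ (j, 0) = d}" for c d
  \<comment> \<open>\<open>B (a, b)\<close> collects the row pairs \<open>(i, j)\<close> at which
    \<open>(f1, f3)\<close> shows \<open>(a, b)\<close> and \<open>(f2, f4)\<close> shows the
    matching levels \<open>(\<pi> a, \<rho> b)\<close>.\<close>
  define B where "B x = S (fst x) (snd x) \<times> T (\<pi> (fst x)) (\<rho> (snd x))" for x
  define K where "K = {k. k < n1 * n2 \<and> u (f1 $$ (k div n2, 0)) (f2 $$ (k mod n2, 0)) = s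
    \<and> v (f3 $$ (k div n2, 0)) (f4 $$ (k mod n2, 0)) = t}"
  have bounds: "k div n2 < n1" "k mod n2 < n2" if "k < n1 * n2" for k
  proof -
    have "0 < n2" using that by (cases n2) auto
    then show "k div n2 < n1" "k mod n2 < n2"
      using that by (auto simp: less_mult_imp_div_less)
  qed
  \<comment> \<open>Row \<open>k\<close> of a Kronecker combination joins row
    \<open>k div n2\<close> of the first factor to row \<open>k mod n2\<close> of the
    second.\<close>
  have "bij_betw (\<lambda>k. (k div n2, k mod n2)) K (\<Union>x\<in>I \<times> J. B x)"
  proof (rule bij_betwI[where g = "\<lambda>(i, j). i * n2 + j"])
    show "(\<lambda>k. (k div n2, k mod n2)) \<in> K \<rightarrow> (\<Union>x\<in>I \<times> J. B x)"
    proof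
      fix k assume k: "k \<in> K"
      then have lt: "k div n2 < n1" "k mod n2 < n2"
        using bounds by (auto simp: K_def)
      define a where "a = f1 $$ (k div n2, 0)"
      define b where "b = f3 $$ (k div n2, 0)"
      have "a \<in> I \<and> f2 $$ (k mod n2, 0) = \<pi> a"
        using I[of a "f2 $$ (k mod n2, 0)"] k l(3)[OF lt(1)] l(6)[OF lt(2)]
        by (simp add: K_def a_def)
      moreover have "b \<in> J \<and> f4 $$ (k mod n2, 0) = \<rho> b"
        using J[of b "f4 $$ (k mod n2, 0)"] k l(9)[OF lt(1)] l(12)[OF lt(2)]
        by (simp add: K_def b_def)
      ultimately have "(a, b) \<in> I \<times> J" "(k div n2, k mod n2) \<in> B (a, b)"
        using lt by (auto simp: B_def S_def T_def a_def b_def)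
      then show "(k div n2, k mod n2) \<in> (\<Union>x\<in>I \<times> J. B x)" by blast
    qed
    show "(\<lambda>(i, j). i * n2 + j) \<in> (\<Union>x\<in>I \<times> J. B x) \<rightarrow> K"
    proof
      fix y assume "y \<in> (\<Union>x\<in>I \<times> J. B x)"
      then obtain a b i j where ab: "a \<in> I" "b \<in> J" and y: "y = (i, j)"
        and i: "i < n1" "f1 $$ (i, 0) = a" "f3 $$ (i, 0) = b"
        and j: "j < n2" "f2 $$ (j, 0) = \<pi> a" "f4 $$ (j, 0) = \<rho> b"
        by (auto simp: B_def S_def T_def)
      have bnd: "a < q1" "\<pi> a < q2" "b < q3" "\<rho> b < q4"
        using ab sub by blast+
      have "i * n2 + j < n1 * n2"
      proof -
        have "i * n2 + j < Suc i * n2" using j(1) by simp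
        also have "\<dots> \<le> n1 * n2" using i(1) by (intro mult_le_mono1) simp
        finally show ?thesis .
      qed
      moreover have "u a (\<pi> a) = s" "v b (\<rho> b) = t"
        using I[OF bnd(1,2)] J[OF bnd(3,4)] ab by auto
      ultimately show "(case y of (i, j) \<Rightarrow> i * n2 + j) \<in> K"
        using i j y by (auto simp: K_def)
    qed
  qed (auto simp: B_def T_def)
  then have "card K = card (\<Union>x\<in>I \<times> J. B x)"
    by (rule bij_betw_same_card)
  \<comment> \<open>The sets \<open>B x\<close> are disjoint because the row \<open>i\<close> alone
    determines \<open>(a, b)\<close>.\<close>
  also have "\<dots> = (\<Sum>x\<in>I \<times> J. card (B x))"
    by (rule card_UN_disjoint) (use fin in \<open>auto simp: B_def S_def T_def\<close>)
  also have "\<dots> = (\<Sum>a\<in>I. \<Sum>b\<in>J. card (S a b) * card (T (\<pi> a) (\<rho> b)))"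
    by (simp add: sum.cartesian_product B_def card_cartesian_product case_prod_beta)
  finally have "card K = (\<Sum>a\<in>I. \<Sum>b\<in>J. card (S a b) * card (T (\<pi> a) (\<rho> b)))" .
  moreover have "level_count (kronecker_by u f1 f2) (kronecker_by v f3 f4) s t = card K"
    unfolding level_count_def kronecker_by_def K_def
    by (rule arg_cong[of _ _ card], rule Collect_cong)
      (simp add: l(1,2,4,5,7,8,10,11) cong: conj_cong)
  ultimately show ?thesis
    by (simp add: level_count_def S_def T_def l(1,4))
qed

section \<open>Identities and inequalities for sums\<close>

text \<open>The numbers below \<open>m * n\<close> are two-digit numerals with leading digit below
  \<open>m\<close> and last digit below \<open>n\<close>. The induction on \<open>m\<close> splits
  off the block with the largest leading digit.\<close>

lemma sum_lessThan_mult: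
  fixes g :: "nat \<Rightarrow> nat \<Rightarrow> 'a::comm_monoid_add"
  shows "(\<Sum>s<m * n. g (s div n) (s mod n)) = (\<Sum>a<m. \<Sum>c<n. g a c)"
proof (induction m)
  case (Suc m)
  have "(\<Sum>s<Suc m * n. g (s div n) (s mod n)) =
      (\<Sum>s<m * n. g (s div n) (s mod n)) + (\<Sum>s=m * n..<m * n + n. g (s div n) (s mod n))"
    by (simp add: lessThan_atLeast0 add.commute sum.atLeastLessThan_concat)
  also have "(\<Sum>s=m * n..<m * n + n. g (s div n) (s mod n)) =
      (\<Sum>c<n. g ((m * n + c) div n) ((m * n + c) mod n))"
    by (rule sum.reindex_bij_witness[of _ "\<lambda>c. m * n + c" "\<lambda>s. s - m * n"]) auto
  also have "\<dots> = (\<Sum>c<n. g m c)"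
    by (intro sum.cong) auto
  finally show ?case using Suc.IH by simp
qed simp

text \<open>The difference inside the square is
  \<open>(x a b + \<mu>) * y c d + \<nu> * x a b\<close>. For fixed \<open>w = x a b\<close>, the
  cross term of its square is linear in \<open>y\<close> and vanishes on summation. What remains is
  quadratic in \<open>w\<close>, and its linear part vanishes when summed over \<open>a\<close> and
  \<open>b\<close>.\<close>

lemma sum_square_product:
  fixes x y :: "nat \<Rightarrow> nat \<Rightarrow> real" and \<mu> \<nu> :: real
  assumes x: "(\<Sum>a<q1. \<Sum>b<q3. x a b) = 0" and y: "(\<Sum>c<q2. \<Sum>d<q4. y c d) = 0"
  shows "(\<Sum>a<q1. \<Sum>c<q2. \<Sum>b<q3. \<Sum>d<q4. ((x a b + \<mu>) * (y c d + \<nu>) - \<mu> * \<nu>)\<^sup>2) =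
    (\<Sum>a<q1. \<Sum>b<q3. (x a b)\<^sup>2) * (\<Sum>c<q2. \<Sum>d<q4. (y c d)\<^sup>2)
    + real q2 * real q4 * \<nu>\<^sup>2 * (\<Sum>a<q1. \<Sum>b<q3. (x a b)\<^sup>2)
    + real q1 * real q3 * \<mu>\<^sup>2 * (\<Sum>c<q2. \<Sum>d<q4. (y c d)\<^sup>2)"
proof -
  define X where "X = (\<Sum>a<q1. \<Sum>b<q3. (x a b)\<^sup>2)"
  define Y where "Y = (\<Sum>c<q2. \<Sum>d<q4. (y c d)\<^sup>2)"
  have inner: "(\<Sum>c<q2. \<Sum>d<q4. ((w + \<mu>) * (y c d + \<nu>) - \<mu> * \<nu>)\<^sup>2) =
      (w + \<mu>)\<^sup>2 * Y + real q2 * real q4 * \<nu>\<^sup>2 * w\<^sup>2" for w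
  proof -
    have "(\<Sum>c<q2. \<Sum>d<q4. ((w + \<mu>) * (y c d + \<nu>) - \<mu> * \<nu>)\<^sup>2) =
        (\<Sum>c<q2. \<Sum>d<q4. (w + \<mu>)\<^sup>2 * (y c d)\<^sup>2 + 2 * (w + \<mu>) * w * \<nu> * y c d + \<nu>\<^sup>2 * w\<^sup>2)"
      by (intro sum.cong refl) (simp add: power2_eq_square algebra_simps)
    also have "\<dots> = (w + \<mu>)\<^sup>2 * Y + 2 * (w + \<mu>) * w * \<nu> * (\<Sum>c<q2. \<Sum>d<q4. y c d)
        + real q2 * real q4 * \<nu>\<^sup>2 * w\<^sup>2"
      by (simp add: Y_def sum.distrib sum_distrib_left)
    finally show ?thesis using y by simp
  qed
  have "(\<Sum>a<q1. \<Sum>c<q2. \<Sum>b<q3. \<Sum>d<q4. ((x a b + \<mu>) * (y c d + \<nu>) - \<mu> * \<nu>)\<^sup>2) =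
      (\<Sum>a<q1. \<Sum>b<q3. \<Sum>c<q2. \<Sum>d<q4. ((x a b + \<mu>) * (y c d + \<nu>) - \<mu> * \<nu>)\<^sup>2)"
    by (intro sum.cong refl sum.swap)
  also have "\<dots> = (\<Sum>a<q1. \<Sum>b<q3. (Y + real q2 * real q4 * \<nu>\<^sup>2) * (x a b)\<^sup>2
      + 2 * \<mu> * Y * x a b + \<mu>\<^sup>2 * Y)"
    unfolding inner by (intro sum.cong refl) (simp add: power2_eq_square algebra_simps)
  also have "\<dots> = (Y + real q2 * real q4 * \<nu>\<^sup>2) * X + 2 * \<mu> * Y * (\<Sum>a<q1. \<Sum>b<q3. x a b)
      + real q1 * real q3 * \<mu>\<^sup>2 * Y"
    by (simp add: X_def sum.distrib sum_distrib_left)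
  finally show ?thesis
    using x by (simp add: X_def Y_def algebra_simps)
qed

lemma sum_shifted_product:
  fixes x y :: "'i \<Rightarrow> real" and \<mu> \<nu> :: real
  assumes "finite K" "sum x K = 0" "sum y K = 0"
  shows "(\<Sum>k\<in>K. (x k + \<mu>) * (y k + \<nu>)) = (\<Sum>k\<in>K. x k * y k) + card K * (\<mu> * \<nu>)"
proof -
  have "(\<Sum>k\<in>K. (x k + \<mu>) * (y k + \<nu>)) =
      (\<Sum>k\<in>K. x k * y k) + \<nu> * sum x K + \<mu> * sum y K + card K * (\<mu> * \<nu>)"
    by (simp add: sum.distrib sum_distrib_left algebra_simps)
  then show ?thesis using assms by simp
qed

text \<open>Subtracting the constant leaves exactly the inner product of \<open>x\<close> and
  \<open>y\<close>, to which Cauchy-Schwarz applies.\<close>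

lemma shifted_product_square_le:
  fixes x y :: "'i \<Rightarrow> real" and \<mu> \<nu> :: real
  assumes "finite K" "sum x K = 0" "sum y K = 0"
  shows "((\<Sum>k\<in>K. (x k + \<mu>) * (y k + \<nu>)) - card K * (\<mu> * \<nu>))\<^sup>2 \<le>
    (\<Sum>k\<in>K. (x k)\<^sup>2) * (\<Sum>k\<in>K. (y k)\<^sup>2)"
  using Cauchy_Schwarz_ineq_sum[of x y K] by (simp add: sum_shifted_product[OF assms])

text \<open>Since \<open>c * X * Y\<close> alone already bounds \<open>L\<close>, equality forces
  the minimum to be zero. If \<open>X\<close> or \<open>Y\<close> is zero, both sides are zero. The
  last two assumptions cover zero weights and are crossed on purpose: \<open>\<alpha>\<close>
  multiplies \<open>X\<close> but stems from the length of the columns behind \<open>Y\<close>, and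
  likewise for \<open>\<beta>\<close>.\<close>

lemma bound_plus_min:
  fixes L X Y c \<alpha> \<beta> :: real
  assumes "0 \<le> L" "L \<le> c * X * Y" "0 \<le> X" "0 \<le> Y" "0 \<le> \<alpha>" "0 \<le> \<beta>"
    and "\<alpha> = 0 \<Longrightarrow> Y = 0" "\<beta> = 0 \<Longrightarrow> X = 0"
  shows "L \<le> c * X * Y + min (\<alpha> * X) (\<beta> * Y)"
    and "L = c * X * Y + min (\<alpha> * X) (\<beta> * Y) \<longleftrightarrow> X = 0 \<or> Y = 0"
proof -
  have nonneg: "0 \<le> \<alpha> * X" "0 \<le> \<beta> * Y" using assms by auto
  then show "L \<le> c * X * Y + min (\<alpha> * X) (\<beta> * Y)"
    using assms(2) by linarith
  show "L = c * X * Y + min (\<alpha> * X) (\<beta> * Y) \<longleftrightarrow> X = 0 \<or> Y = 0"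
  proof
    assume "L = c * X * Y + min (\<alpha> * X) (\<beta> * Y)"
    then have "\<alpha> * X = 0 \<or> \<beta> * Y = 0"
      using assms(2) nonneg by linarith
    then show "X = 0 \<or> Y = 0" using assms by auto
  next
    assume "X = 0 \<or> Y = 0"
    then show "L = c * X * Y + min (\<alpha> * X) (\<beta> * Y)"
      using assms nonneg by auto
  qed
qed

section \<open>Pairs of group elements with a given product\<close>

lemma group_solve:
  fixes G :: "nat monoid"
  assumes "group G" "carrier G = {0..<q}" "s < q" "a < q" "c < q"
  shows "a \<otimes>\<^bsub>G\<^esub> c = s \<longleftrightarrow> c = inv\<^bsub>G\<^esub> a \<otimes>\<^bsub>G\<^esub> s"
  using group.inv_solve_left[OF assms(1), of c a s] assms by auto

text \<open>Two elements with product \<open>s\<close> determine each other, the inverse map being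
  \<open>s\<close> times the inverse of \<open>c\<close>. Pairing by product thus only permutes the
  levels of the second factor, and sums over them do not change.\<close>

lemma bij_betw_inv_mult:
  fixes G :: "nat monoid"
  assumes G: "group G" "carrier G = {0..<q}" and s: "s < q"
  shows "bij_betw (\<lambda>a. inv\<^bsub>G\<^esub> a \<otimes>\<^bsub>G\<^esub> s) {..<q} {..<q}"
proof -
  interpret group G by (fact G(1))
  have s': "s \<in> carrier G" using s G(2) by simp
  have "bij_betw (\<lambda>a. inv\<^bsub>G\<^esub> a \<otimes>\<^bsub>G\<^esub> s) (carrier G) (carrier G)"
    by (rule bij_betwI[where g = "\<lambda>c. s \<otimes>\<^bsub>G\<^esub> inv\<^bsub>G\<^esub> c"])
      (use s' in \<open>auto simp: inv_mult_group m_assoc[symmetric]\<close>, simp_all add: m_assoc)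
  then show ?thesis using G(2) by (simp add: lessThan_atLeast0)
qed

section \<open>The identity and the two bounds for four columns\<close>

locale column_quadruple =
  fixes q1 q2 q3 q4 n1 n2 :: nat and f1 f2 f3 f4 :: "nat mat"
  assumes f1: "level_column q1 n1 f1" "balanced q1 f1"
    and f2: "level_column q2 n2 f2" "balanced q2 f2"
    and f3: "level_column q3 n1 f3" "balanced q3 f3"
    and f4: "level_column q4 n2 f4" "balanced q4 f4"
    and pos: "0 < q1" "0 < q2" "0 < q3" "0 < q4"
begin

abbreviation "x \<equiv> deviation q1 q3 f1 f3"
abbreviation "y \<equiv> deviation q2 q4 f2 f4"
abbreviation "\<mu> \<equiv> real n1 / (real q1 * real q3)"
abbreviation "\<nu> \<equiv> real n2 / (real q2 * real q4)"

lemma counts: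
  "real (level_count f1 f3 a b) = x a b + \<mu>"
  "real (level_count f2 f4 c d) = y c d + \<nu>"
  using level_columnD(1)[OF f1(1)] level_columnD(1)[OF f2(1)]
  by (simp_all add: level_count_eq_deviation[of f1 f3 _ _ q1 q3]
      level_count_eq_deviation[of f2 f4 _ _ q2 q4])

lemma dim_row_kronecker_by: "dim_row (kronecker_by u f1 f2) = n1 * n2"
  using level_columnD(1)[OF f1(1)] level_columnD(1)[OF f2(1)] by (simp add: kronecker_by_def)

lemma sum_x: "b < q3 \<Longrightarrow> (\<Sum>a<q1. x a b) = 0"
  using sum_deviation_fst[OF f1(1) f3 pos(1)] by simp

lemma sum_y: "d < q4 \<Longrightarrow> (\<Sum>c<q2. y c d) = 0"
  using sum_deviation_fst[OF f2(1) f4 pos(2)] by simp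

lemma sum_sum_xy: "(\<Sum>a<q1. \<Sum>b<q3. x a b) = 0" "(\<Sum>c<q2. \<Sum>d<q4. y c d) = 0"
  by (subst sum.swap, simp add: sum_x sum_y)+

text \<open>The singleton gives the equivalence the shape of the assumptions \<open>I\<close> and
  \<open>J\<close> of \<open>level_count_kronecker_by\<close>, with a constant map for the second
  digit.\<close>

lemma digits:
  fixes a c n s :: nat
  assumes "c < n"
  shows "a * n + c = s \<longleftrightarrow> a \<in> {s div n} \<and> c = s mod n"
  using assms by auto

text \<open>A level of either combination has a single pair of digits, so every level count is one
  product of two counts and \<open>sum_square_product\<close> applies.\<close>

lemma f_NOD_lexicographic:
  "f_NOD (q1 * q2) (q3 * q4) (kronecker_by (\<lambda>a c. a * q2 + c) f1 f2)
      (kronecker_by (\<lambda>b d. b * q4 + d) f3 f4) =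
    f_NOD q1 q3 f1 f3 * f_NOD q2 q4 f2 f4
    + (real n2)\<^sup>2 / (real q2 * real q4) * f_NOD q1 q3 f1 f3
    + (real n1)\<^sup>2 / (real q1 * real q3) * f_NOD q2 q4 f2 f4"
proof -
  let ?h1 = "kronecker_by (\<lambda>a c. a * q2 + c) f1 f2"
  let ?h2 = "kronecker_by (\<lambda>b d. b * q4 + d) f3 f4"
  have count: "level_count ?h1 ?h2 s t = level_count f1 f3 (s div q2) (t div q4)
      * level_count f2 f4 (s mod q2) (t mod q4)" if "s < q1 * q2" "t < q3 * q4" for s t
    by (subst level_count_kronecker_by[OF f1(1) f2(1) f3(1) f4(1) digits digits])
      (use that pos in \<open>auto simp: less_mult_imp_div_less\<close>)
  have "f_NOD (q1 * q2) (q3 * q4) ?h1 ?h2 = (\<Sum>s<q1 * q2. \<Sum>t<q3 * q4.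
      ((x (s div q2) (t div q4) + \<mu>) * (y (s mod q2) (t mod q4) + \<nu>) - \<mu> * \<nu>)\<^sup>2)"
    unfolding f_NOD_def dim_row_kronecker_by
    by (intro sum.cong refl) (simp add: count counts mult_ac)
  also have "\<dots> = (\<Sum>a<q1. \<Sum>c<q2. \<Sum>b<q3. \<Sum>d<q4. ((x a b + \<mu>) * (y c d + \<nu>) - \<mu> * \<nu>)\<^sup>2)"
    \<comment> \<open>The inner sum over \<open>t\<close> is split into digits for fixed
      \<open>s\<close>; the outer sum over \<open>s\<close> follows.\<close>
    unfolding sum_lessThan_mult[where n = q4 and m = q3 and
        g = "\<lambda>b d. ((x _ b + \<mu>) * (y _ d + \<nu>) - \<mu> * \<nu>)\<^sup>2"]
    by (rule sum_lessThan_mult[where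
        g = "\<lambda>a c. \<Sum>b<q3. \<Sum>d<q4. ((x a b + \<mu>) * (y c d + \<nu>) - \<mu> * \<nu>)\<^sup>2"])
  also have "\<dots> = f_NOD q1 q3 f1 f3 * f_NOD q2 q4 f2 f4
      + real q2 * real q4 * \<nu>\<^sup>2 * f_NOD q1 q3 f1 f3 + real q1 * real q3 * \<mu>\<^sup>2 * f_NOD q2 q4 f2 f4"
    unfolding f_NOD_eq_deviation by (rule sum_square_product[OF sum_sum_xy])
  finally show ?thesis
    using pos by (simp add: power2_eq_square)
qed

text \<open>For each level pair \<open>(s, t)\<close>, Cauchy-Schwarz over all pairs in
  \<open>K\<close> bounds the squared deviation by the product of the two values of
  \<open>f_NOD\<close>. There are \<open>q1 * q3\<close> such \<open>(s, t)\<close>, whence the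
  factor.\<close>

lemma f_NOD_group_group_le:
  assumes q: "q1 = q2" "q3 = q4"
    and G: "group G" "carrier G = {0..<q1}" and H: "group H" "carrier H = {0..<q3}"
  shows "f_NOD q1 q3 (kronecker_sum_group G f1 f2) (kronecker_sum_group H f3 f4) \<le>
    real q1 * real q3 * f_NOD q1 q3 f1 f3 * f_NOD q2 q4 f2 f4"
proof -
  let ?F = "kronecker_sum_group G f1 f2" and ?G = "kronecker_sum_group H f3 f4"
  define K where "K = {..<q1} \<times> {..<q3}"
  have XY: "f_NOD q1 q3 f1 f3 = (\<Sum>k\<in>K. (x (fst k) (snd k))\<^sup>2)"
    "f_NOD q2 q4 f2 f4 = (\<Sum>k\<in>K. (y (fst k) (snd k))\<^sup>2)"
    by (simp_all add: f_NOD_eq_deviation K_def sum.cartesian_product case_prod_beta q)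
  have "(real (level_count ?F ?G s t) - real (dim_row ?F) / (real q1 * real q3))\<^sup>2 \<le>
      f_NOD q1 q3 f1 f3 * f_NOD q2 q4 f2 f4" if st: "s < q1" "t < q3" for s t
  proof -
    define \<pi> where "\<pi> a = inv\<^bsub>G\<^esub> a \<otimes>\<^bsub>G\<^esub> s" for a
    define \<rho> where "\<rho> b = inv\<^bsub>H\<^esub> b \<otimes>\<^bsub>H\<^esub> t" for b
    define \<phi> where "\<phi> k = (\<pi> (fst k), \<rho> (snd k))" for k
    have \<phi>: "\<phi> = map_prod \<pi> \<rho>"
      by (auto simp: \<phi>_def)
    have bij: "bij_betw \<phi> K K"
      unfolding \<phi> K_def \<pi>_def \<rho>_def
      by (rule bij_betw_map_prod[OF bij_betw_inv_mult[OF G st(1)] bij_betw_inv_mult[OF H st(2)]])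
    have reindex: "(\<Sum>k\<in>K. g (\<pi> (fst k)) (\<rho> (snd k))) = (\<Sum>k\<in>K. g (fst k) (snd k))"
      for g :: "nat \<Rightarrow> nat \<Rightarrow> real"
      using sum.reindex_bij_betw[OF bij, of "\<lambda>k. g (fst k) (snd k)"] by (simp add: \<phi>_def)
    have "level_count ?F ?G s t =
        (\<Sum>a<q1. \<Sum>b<q3. level_count f1 f3 a b * level_count f2 f4 (\<pi> a) (\<rho> b))"
      unfolding kronecker_sum_group_def
    proof (rule level_count_kronecker_by[OF f1(1) f2(1) f3(1) f4(1)])
      show "(a \<otimes>\<^bsub>G\<^esub> c = s) \<longleftrightarrow> a \<in> {..<q1} \<and> c = \<pi> a" if "a < q1" "c < q2" for a c
        using group_solve[OF G st(1)] that q by (simp add: \<pi>_def)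
      show "(b \<otimes>\<^bsub>H\<^esub> d = t) \<longleftrightarrow> b \<in> {..<q3} \<and> d = \<rho> b" if "b < q3" "d < q4" for b d
        using group_solve[OF H st(2)] that q by (simp add: \<rho>_def)
      show "\<pi> ` {..<q1} \<subseteq> {..<q2}"
        using bij_betw_imp_surj_on[OF bij_betw_inv_mult[OF G st(1)]] q by (simp add: \<pi>_def)
      show "\<rho> ` {..<q3} \<subseteq> {..<q4}"
        using bij_betw_imp_surj_on[OF bij_betw_inv_mult[OF H st(2)]] q by (simp add: \<rho>_def)
    qed auto
    then have "real (level_count ?F ?G s t) =
        (\<Sum>k\<in>K. (x (fst k) (snd k) + \<mu>) * (y (\<pi> (fst k)) (\<rho> (snd k)) + \<nu>))"
      by (simp add: counts K_def sum.cartesian_product case_prod_beta)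
    \<comment> \<open>As \<open>K\<close> has \<open>q1 * q3\<close> elements,
      \<open>q1 = q2\<close> and \<open>q3 = q4\<close> make both sides
      \<open>n1 * n2 / (q1 * q3)\<close>.\<close>
    moreover have "real (dim_row ?F) / (real q1 * real q3) = card K * (\<mu> * \<nu>)"
      using pos q by (simp add: kronecker_sum_group_def dim_row_kronecker_by K_def
          card_cartesian_product)
    moreover have "(\<Sum>k\<in>K. x (fst k) (snd k)) = 0"
      using sum_sum_xy(1) by (simp add: K_def sum.cartesian_product case_prod_beta)
    moreover have "(\<Sum>k\<in>K. y (\<pi> (fst k)) (\<rho> (snd k))) = 0"
      using sum_sum_xy(2) unfolding reindex
      by (simp add: K_def sum.cartesian_product case_prod_beta q)
    ultimately show ?thesis
      using shifted_product_square_le[of K "\<lambda>k. x (fst k) (snd k)"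
          "\<lambda>k. y (\<pi> (fst k)) (\<rho> (snd k))" \<mu> \<nu>] reindex[of "\<lambda>c d. (y c d)\<^sup>2"]
      by (simp add: XY) (simp add: K_def)
  qed
  then have "f_NOD q1 q3 ?F ?G \<le> (\<Sum>s<q1. \<Sum>t<q3. f_NOD q1 q3 f1 f3 * f_NOD q2 q4 f2 f4)"
    unfolding f_NOD_def[of _ _ ?F] by (intro sum_mono) auto
  then show ?thesis by (simp add: mult_ac)
qed

text \<open>The digits of \<open>t\<close> fix the levels of \<open>f3\<close> and
  \<open>f4\<close>, so Cauchy-Schwarz runs over the level of \<open>f1\<close> only and gives
  \<open>X (t div q4) * Y (t mod q4)\<close>. Summed over \<open>t\<close> this factors into the two
  full values of \<open>f_NOD\<close>; the sum over \<open>s\<close> contributes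
  \<open>q1\<close>.\<close>

lemma f_NOD_group_lexicographic_le:
  assumes q: "q1 = q2" and G: "group G" "carrier G = {0..<q1}"
  shows "f_NOD q1 (q3 * q4) (kronecker_sum_group G f1 f2)
      (kronecker_by (\<lambda>b d. b * q4 + d) f3 f4) \<le>
    real q1 * f_NOD q1 q3 f1 f3 * f_NOD q2 q4 f2 f4"
proof -
  let ?F = "kronecker_sum_group G f1 f2" and ?h = "kronecker_by (\<lambda>b d. b * q4 + d) f3 f4"
  define X where "X b = (\<Sum>a<q1. (x a b)\<^sup>2)" for b
  define Y where "Y d = (\<Sum>c<q2. (y c d)\<^sup>2)" for d
  have XY: "f_NOD q1 q3 f1 f3 = (\<Sum>b<q3. X b)" "f_NOD q2 q4 f2 f4 = (\<Sum>d<q4. Y d)"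
    unfolding f_NOD_eq_deviation X_def Y_def by (rule sum.swap)+
  have "(real (level_count ?F ?h s t) - real (dim_row ?F) / (real q1 * real (q3 * q4)))\<^sup>2 \<le>
      X (t div q4) * Y (t mod q4)" if st: "s < q1" "t < q3 * q4" for s t
  proof -
    define \<pi> where "\<pi> a = inv\<^bsub>G\<^esub> a \<otimes>\<^bsub>G\<^esub> s" for a
    have lt: "t div q4 < q3" "t mod q4 < q4"
      using st pos by (auto simp: less_mult_imp_div_less)
    have bij: "bij_betw \<pi> {..<q1} {..<q1}"
      unfolding \<pi>_def by (rule bij_betw_inv_mult[OF G st(1)])
    have reindex: "(\<Sum>a<q1. g (\<pi> a)) = (\<Sum>a<q1. g a)" for g :: "nat \<Rightarrow> real"
      by (rule sum.reindex_bij_betw[OF bij])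
    have "level_count ?F ?h s t = (\<Sum>a<q1. \<Sum>b\<in>{t div q4}.
        level_count f1 f3 a b * level_count f2 f4 (\<pi> a) (t mod q4))"
      unfolding kronecker_sum_group_def
    proof (rule level_count_kronecker_by[OF f1(1) f2(1) f3(1) f4(1) _ digits])
      show "(a \<otimes>\<^bsub>G\<^esub> c = s) \<longleftrightarrow> a \<in> {..<q1} \<and> c = \<pi> a" if "a < q1" "c < q2" for a c
        using group_solve[OF G st(1)] that q by (simp add: \<pi>_def)
      show "\<pi> ` {..<q1} \<subseteq> {..<q2}"
        using bij_betw_imp_surj_on[OF bij] q by simp
    qed (use lt in auto)
    then have "real (level_count ?F ?h s t) =
        (\<Sum>a<q1. (x a (t div q4) + \<mu>) * (y (\<pi> a) (t mod q4) + \<nu>))"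
      by (simp add: counts)
    moreover have "real (dim_row ?F) / (real q1 * real (q3 * q4)) = card {..<q1} * (\<mu> * \<nu>)"
      using pos q by (simp add: kronecker_sum_group_def dim_row_kronecker_by)
    ultimately show ?thesis
      using shifted_product_square_le[of "{..<q1}" "\<lambda>a. x a (t div q4)"
          "\<lambda>a. y (\<pi> a) (t mod q4)" \<mu> \<nu>] sum_x[OF lt(1)] sum_y[OF lt(2)] q
        reindex[of "\<lambda>c. y c (t mod q4)"] reindex[of "\<lambda>c. (y c (t mod q4))\<^sup>2"]
      by (simp add: X_def Y_def)
  qed
  then have "f_NOD q1 (q3 * q4) ?F ?h \<le> (\<Sum>s<q1. \<Sum>t<q3 * q4. X (t div q4) * Y (t mod q4))"
    unfolding f_NOD_def[of _ _ ?F] by (intro sum_mono) auto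
  also have "\<dots> = (\<Sum>s<q1. \<Sum>b<q3. \<Sum>d<q4. X b * Y d)"
    by (simp add: sum_lessThan_mult[where g = "\<lambda>b d. X b * Y d"])
  also have "\<dots> = real q1 * f_NOD q1 q3 f1 f3 * f_NOD q2 q4 f2 f4"
    by (simp add: XY sum_product)
  finally show ?thesis .
qed

end

section \<open>From the centred real columns to natural levels, and the conclusion\<close>

text \<open>The centring constants cancel:
  \<open>- q2 * (q1 - 1) / 2 - (q2 - 1) / 2 + (q1 * q2 - 1) / 2 = 0\<close>.\<close>

lemma lexicographic_column_eq:
  assumes "level_column q1 n1 f1" "level_column q2 n2 f2"
  shows "scalar_plus ((real q1 * real q2 - 1) / 2)
     (kronecker_sum (real q2 \<cdot>\<^sub>m scalar_plus (- ((real q1 - 1) / 2)) (map_mat real f1))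
       (scalar_plus (- ((real q2 - 1) / 2)) (map_mat real f2))) =
    map_mat real (kronecker_by (\<lambda>a c. a * q2 + c) f1 f2)"
proof (rule eq_matI, goal_cases)
  case (1 i j)
  then have i: "i < n1 * n2" and j: "j = 0"
    using assms[THEN level_columnD(1)] assms[THEN level_columnD(2)]
    by (auto simp: kronecker_by_def)
  then have "0 < n2" by (cases n2) auto
  then have "i div n2 < n1" "i mod n2 < n2"
    using i by (auto simp: less_mult_imp_div_less)
  then show ?case
    using i j assms[THEN level_columnD(1)] assms[THEN level_columnD(2)]
    by (simp add: scalar_plus_def kronecker_sum_def kronecker_by_def field_simps)
qed (auto simp: scalar_plus_def kronecker_sum_def kronecker_by_def)

text \<open>The embedding of the naturals into the reals is injective. Two real columns occur in
  (a), a natural and a real one in (c).\<close>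

lemma level_count_map_real:
  assumes "dim_row f = dim_row g" "0 < dim_col f" "0 < dim_col g"
  shows "level_count (map_mat real f) (map_mat real g) a b = level_count f g a b"
    and "level_count f (map_mat real g) a b = level_count f g a b"
  using assms unfolding level_count_def by (auto intro!: arg_cong[of _ _ card])

theorem theorem6:
  fixes n q :: "nat \<Rightarrow> nat"
    and f :: "nat \<Rightarrow> nat mat"
    and A :: "nat \<Rightarrow> nat monoid"
    and h1 h2 :: "real mat"
  assumes columns: "\<And>i. i \<in> {1..4} \<Longrightarrow> level_column (q i) (n i) (f i)"
    and bal: "\<And>i. i \<in> {1..4} \<Longrightarrow> balanced (q i) (f i)"
    and groups: "\<And>i. i \<in> {1..4} \<Longrightarrow> comm_group (A i)"
    and carriers: "\<And>i. i \<in> {1..4} \<Longrightarrow> carrier (A i) = {0..<q i}"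
    and lengths: "n 1 = n 3" "n 2 = n 4"
    and h1: "h1 = scalar_plus ((real (q 1) * real (q 2) - 1) / 2)
               (kronecker_sum
                 (real (q 2) \<cdot>\<^sub>m scalar_plus (- ((real (q 1) - 1) / 2)) (map_mat real (f 1)))
                 (scalar_plus (- ((real (q 2) - 1) / 2)) (map_mat real (f 2))))"
    and h2: "h2 = scalar_plus ((real (q 3) * real (q 4) - 1) / 2)
               (kronecker_sum
                 (real (q 4) \<cdot>\<^sub>m scalar_plus (- ((real (q 3) - 1) / 2)) (map_mat real (f 3)))
                 (scalar_plus (- ((real (q 4) - 1) / 2)) (map_mat real (f 4))))"
  shows
    "f_NOD (q 1 * q 2) (q 3 * q 4) h1 h2 =
       f_NOD (q 1) (q 3) (f 1) (f 3) * f_NOD (q 2) (q 4) (f 2) (f 4)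
       + (real (n 2))\<^sup>2 / (real (q 2) * real (q 4)) * f_NOD (q 1) (q 3) (f 1) (f 3)
       + (real (n 1))\<^sup>2 / (real (q 1) * real (q 3)) * f_NOD (q 2) (q 4) (f 2) (f 4)
     \<and>
     (q 1 = q 2 \<and> q 3 = q 4 \<and> same_group (A 1) (A 2) \<and> same_group (A 3) (A 4) \<longrightarrow>
       (let lhs = f_NOD (q 1) (q 3) (kronecker_sum_group (A 1) (f 1) (f 2))
                                    (kronecker_sum_group (A 3) (f 3) (f 4));
            rhs = real (q 1) * real (q 3)
                    * f_NOD (q 1) (q 3) (f 1) (f 3) * f_NOD (q 2) (q 4) (f 2) (f 4)
                  + min ((real (n 2))\<^sup>2 * f_NOD (q 1) (q 3) (f 1) (f 3))
                        ((real (n 1))\<^sup>2 * f_NOD (q 2) (q 4) (f 2) (f 4))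
        in lhs \<le> rhs \<and>
           (lhs = rhs \<longleftrightarrow> orthogonal_columns (q 1) (q 3) (f 1) (f 3)
                         \<or> orthogonal_columns (q 2) (q 4) (f 2) (f 4))))
     \<and>
     (q 1 = q 2 \<and> same_group (A 1) (A 2) \<longrightarrow>
       (let lhs = f_NOD (q 1) (q 3 * q 4) (kronecker_sum_group (A 1) (f 1) (f 2)) h2;
            rhs = real (q 1)
                    * f_NOD (q 1) (q 3) (f 1) (f 3) * f_NOD (q 2) (q 4) (f 2) (f 4)
                  + min ((real (n 2))\<^sup>2 / real (q 4) * f_NOD (q 1) (q 3) (f 1) (f 3))
                        ((real (n 1))\<^sup>2 / real (q 3) * f_NOD (q 2) (q 4) (f 2) (f 4))
        in lhs \<le> rhs \<and>
           (lhs = rhs \<longleftrightarrow> orthogonal_columns (q 1) (q 3) (f 1) (f 3)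
                         \<or> orthogonal_columns (q 2) (q 4) (f 2) (f 4))))"
proof -
  \<comment> \<open>The identity element of the group lies in \<open>{0..<q i}\<close>, which is
    therefore nonempty.\<close>
  have q_pos: "0 < q i" if "i \<in> {1..4}" for i
    using monoid.one_closed[OF group.is_monoid[OF comm_group.axioms(2)[OF groups[OF that]]]]
      carriers[OF that] by auto
  interpret column_quadruple "q 1" "q 2" "q 3" "q 4" "n 1" "n 2" "f 1" "f 2" "f 3" "f 4"
    using columns[of 1] columns[of 2] columns[of 3] columns[of 4] bal[of 1] bal[of 2]
      bal[of 3] bal[of 4] q_pos lengths by unfold_locales auto
  note dims = f1(1)[THEN level_columnD(1)] f2(1)[THEN level_columnD(1)]
    f3(1)[THEN level_columnD(1)] f4(1)[THEN level_columnD(1)]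
    f1(1)[THEN level_columnD(2)] f2(1)[THEN level_columnD(2)]
    f3(1)[THEN level_columnD(2)] f4(1)[THEN level_columnD(2)]
  let ?h1 = "kronecker_by (\<lambda>a c. a * q 2 + c) (f 1) (f 2)"
  let ?h2 = "kronecker_by (\<lambda>b d. b * q 4 + d) (f 3) (f 4)"
  let ?X = "f_NOD (q 1) (q 3) (f 1) (f 3)" and ?Y = "f_NOD (q 2) (q 4) (f 2) (f 4)"
  have h: "h1 = map_mat real ?h1" "h2 = map_mat real ?h2"
    unfolding h1 h2 using lexicographic_column_eq f1(1) f2(1) f3(1) f4(1) by auto
  have G: "group (A 1)" "group (A 3)"
    using groups[of 1] groups[of 3] by (auto simp: comm_group_def)
  have orth: "orthogonal_columns (q 1) (q 3) (f 1) (f 3) \<longleftrightarrow> ?X = 0"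
    "orthogonal_columns (q 2) (q 4) (f 2) (f 4) \<longleftrightarrow> ?Y = 0"
    using orthogonal_columns_iff_f_NOD f1(1) f2(1) f3 f4 pos by blast+
  \<comment> \<open>Columns of length zero are allowed. They make a weight in the minimum vanish,
    but then the \<open>f_NOD\<close> of the empty columns is zero as well, as
    \<open>bound_plus_min\<close> requires.\<close>
  have degenerate: "n 2 = 0 \<Longrightarrow> ?Y = 0" "n 1 = 0 \<Longrightarrow> ?X = 0"
    using dims by (auto intro: f_NOD_empty)
  have "f_NOD (q 1 * q 2) (q 3 * q 4) h1 h2 = f_NOD (q 1 * q 2) (q 3 * q 4) ?h1 ?h2"
    unfolding h f_NOD_def by (subst level_count_map_real) (auto simp: kronecker_by_def dims simp del: One_nat_def)
  note a = this[unfolded f_NOD_lexicographic]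
  have h2': "f_NOD (q 1) (q 3 * q 4) (kronecker_sum_group (A 1) (f 1) (f 2)) h2 =
      f_NOD (q 1) (q 3 * q 4) (kronecker_sum_group (A 1) (f 1) (f 2)) ?h2"
    unfolding h f_NOD_def
    by (subst level_count_map_real) (auto simp: kronecker_sum_group_def kronecker_by_def dims simp del: One_nat_def)
  note b = bound_plus_min[OF f_NOD_nonneg f_NOD_group_group_le[OF _ _ G(1) _ G(2)]
      f_NOD_nonneg f_NOD_nonneg, of "(real (n 2))\<^sup>2" "(real (n 1))\<^sup>2"]
  note c = bound_plus_min[OF f_NOD_nonneg f_NOD_group_lexicographic_le[OF _ G(1)]
      f_NOD_nonneg f_NOD_nonneg, of "(real (n 2))\<^sup>2 / real (q 4)" "(real (n 1))\<^sup>2 / real (q 3)"]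
  show ?thesis
    unfolding Let_def orth h2'
    by (intro conjI impI a b c) (use carriers[of 1] carriers[of 3] degenerate pos in auto)
qed

end
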